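(* For an instance of the Capacitated Facility Location Problem with Customer Preferences (CFLCP) with customers $I$, plants $J$, capacities $c_j$, opening costs $f_j$, allocation costs $g_{ij}$ and strict rankings $\prec_i$, consider the model $$\min_{x,y,u,v}\ \sum_{j\in J} f_j y_j+\sum_{i\in I}\sum_{j\in J} g_{ij}x_{ij}$$ subject to $$\sum_{j\in J}x_{ij}=1\quad \forall i\in I,$$ $$\sum_{i\in I}x_{ij}\le (c_j-1)y_j+u_j\quad \forall j\in J,$$ $$c_ju_j\le \sum_{i\in I}x_{ij}\quad \forall j\in J,$$ $$x_{ij}\le y_j\quad \forall i\in I,\ j\in J,$$ $$y_j\le u_j+\sum_{j'\in J:\, j'\preceq_i j}x_{ij'}\quad \forall i\in I,\ j\in J,$$ $$v_{jj'}+v_{j'j}\le 1\quad \forall j\ne j'\in J,$$ $$x_{ij'}\le v_{jj'}\quad \forall i\in I,\ j,j'\in J \text{ with } j\prec_i j',$$ $$x_{ij}\in\{0,1\}\quad \forall i\in I,\ j\in J,\qquad u_j,y_j\in\{0,1\}\quad \forall j\in J,\qquad v_{jj'}\in\{0,1\}\quad \forall j\neq j'\in J.$$ The integrality constraints on the $x$-variables can be relaxed in this model: for every instance, the model obtained by replacing $x_{ij}\in\{0,1\}$ with $0\le x_{ij}\le 1$ for all $i\in I$, $j\in J$ (keeping $u_j,y_j,v_{jj'}\in\{0,1\}$) is feasible if and only if the original model is feasible, and in that case the two models have the same optimal value.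
   Context: An instance of CFLCP consists of a finite set $J$ of potential plants, a finite set $I$ of customers, for each plant $j\in J$ an opening cost $f_j$ and a capacity $c_j$ (a positive integer, the maximum number of customers that can be allocated to $j$), for each pair $(i,j)\in I\times J$ an allocation cost $g_{ij}$, and for each customer $i\in I$ a strict total order $\prec_i$ on $J$, where $j\prec_i j'$ means that $i$ prefers $j$ to $j'$. One writes $j\preceq_i j'$ if $j\prec_i j'$ or $j=j'$. It is assumed that $c_j<|I|$ for at least one $j\in J$. In the model, $y_j=1$ means plant $j$ is open, $x_{ij}=1$ means customer $i$ is allocated to plant $j$, $u_j=1$ means plant $j$ is full, and $v_{jj'}=1$ if some customer who prefers $j$ over $j'$ is assigned to $j'$. *)

theory Defs
  imports Complex_Main
begin

record ('i, 'j) cflcp =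
  customers :: "'i set"
  plants :: "'j set"
  opening_cost :: "'j \<Rightarrow> real"
  capacity :: "'j \<Rightarrow> nat"
  allocation_cost :: "'i \<Rightarrow> 'j \<Rightarrow> real"
  prefers :: "'i \<Rightarrow> 'j \<Rightarrow> 'j \<Rightarrow> bool"

text \<open>\<open>prefers P i j j'\<close> is $j \prec_i j'$. Only its restriction to the set of plants
  is relevant.\<close>

definition strict_total_order_on :: "'a set \<Rightarrow> ('a \<Rightarrow> 'a \<Rightarrow> bool) \<Rightarrow> bool" where
  "strict_total_order_on A R \<longleftrightarrow> irreflp_on A R \<and> transp_on A R \<and> totalp_on A R"

definition cflcp_instance :: "('i, 'j) cflcp \<Rightarrow> bool" where
  "cflcp_instance P \<longleftrightarrow>
     finite (plants P) \<and> finite (customers P) \<and>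
     (\<forall>j\<in>plants P. capacity P j > 0) \<and>
     (\<forall>i\<in>customers P. strict_total_order_on (plants P) (prefers P i)) \<and>
     (\<exists>j\<in>plants P. capacity P j < card (customers P))"

definition weakly_prefers :: "('i, 'j) cflcp \<Rightarrow> 'i \<Rightarrow> 'j \<Rightarrow> 'j \<Rightarrow> bool" where
  "weakly_prefers P i j j' \<longleftrightarrow> prefers P i j j' \<or> j = j'"

text \<open>A point is a tuple \<open>(x, y, u, v)\<close>. Its values outside the index sets, and the diagonal
  values \<open>v j j\<close>, are unconstrained and do not enter the objective.\<close>

type_synonym ('i, 'j) point =
  "('i \<Rightarrow> 'j \<Rightarrow> real) \<times> ('j \<Rightarrow> real) \<times> ('j \<Rightarrow> real) \<times> ('j \<Rightarrow> 'j \<Rightarrow> real)"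

fun objective :: "('i, 'j) cflcp \<Rightarrow> ('i, 'j) point \<Rightarrow> real" where
  "objective P (x, y, u, v) =
     (\<Sum>j\<in>plants P. opening_cost P j * y j)
     + (\<Sum>i\<in>customers P. \<Sum>j\<in>plants P. allocation_cost P i j * x i j)"

fun linear_constraints :: "('i, 'j) cflcp \<Rightarrow> ('i, 'j) point \<Rightarrow> bool" where
  "linear_constraints P (x, y, u, v) \<longleftrightarrow>
     (\<forall>i\<in>customers P. (\<Sum>j\<in>plants P. x i j) = 1) \<and>
     (\<forall>j\<in>plants P. (\<Sum>i\<in>customers P. x i j) \<le> (real (capacity P j) - 1) * y j + u j) \<and>
     (\<forall>j\<in>plants P. real (capacity P j) * u j \<le> (\<Sum>i\<in>customers P. x i j)) \<and>
     (\<forall>i\<in>customers P. \<forall>j\<in>plants P. x i j \<le> y j) \<and>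
     (\<forall>i\<in>customers P. \<forall>j\<in>plants P.
        y j \<le> u j + (\<Sum>j'\<in>{j'\<in>plants P. weakly_prefers P i j' j}. x i j')) \<and>
     (\<forall>j\<in>plants P. \<forall>j'\<in>plants P. j \<noteq> j' \<longrightarrow> v j j' + v j' j \<le> 1) \<and>
     (\<forall>i\<in>customers P. \<forall>j\<in>plants P. \<forall>j'\<in>plants P. prefers P i j j' \<longrightarrow> x i j' \<le> v j j')"

fun binary_yuv :: "('i, 'j) cflcp \<Rightarrow> ('i, 'j) point \<Rightarrow> bool" where
  "binary_yuv P (x, y, u, v) \<longleftrightarrow>
     (\<forall>j\<in>plants P. u j \<in> {0, 1} \<and> y j \<in> {0, 1}) \<and>
     (\<forall>j\<in>plants P. \<forall>j'\<in>plants P. j \<noteq> j' \<longrightarrow> v j j' \<in> {0, 1})"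

fun binary_x :: "('i, 'j) cflcp \<Rightarrow> ('i, 'j) point \<Rightarrow> bool" where
  "binary_x P (x, y, u, v) \<longleftrightarrow> (\<forall>i\<in>customers P. \<forall>j\<in>plants P. x i j \<in> {0, 1})"

fun relaxed_x :: "('i, 'j) cflcp \<Rightarrow> ('i, 'j) point \<Rightarrow> bool" where
  "relaxed_x P (x, y, u, v) \<longleftrightarrow> (\<forall>i\<in>customers P. \<forall>j\<in>plants P. 0 \<le> x i j \<and> x i j \<le> 1)"

definition original_feasible_set :: "('i, 'j) cflcp \<Rightarrow> ('i, 'j) point set" where
  "original_feasible_set P = {s. linear_constraints P s \<and> binary_yuv P s \<and> binary_x P s}"

definition relaxed_feasible_set :: "('i, 'j) cflcp \<Rightarrow> ('i, 'j) point set" where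
  "relaxed_feasible_set P = {s. linear_constraints P s \<and> binary_yuv P s \<and> relaxed_x P s}"

text \<open>The optimal value of a minimization problem is an attained minimum, not merely an
  infimum.\<close>

definition is_optimal_value :: "('s \<Rightarrow> real) \<Rightarrow> 's set \<Rightarrow> real \<Rightarrow> bool" where
  "is_optimal_value F S z \<longleftrightarrow> (\<exists>s. is_arg_min F (\<lambda>s. s \<in> S) s \<and> F s = z)"

end

theory Submission imports Defs begin

text \<open>Once the binary vectors \<open>y\<close>, \<open>u\<close>, \<open>v\<close> are fixed, every constraint on \<open>x\<close> is an integral
  bound on a single entry, on a row sum or on a column sum: in particular, if \<open>y j = 1\<close> and
  \<open>u j = 0\<close>, then the preference constraint says that \<open>x i j' = 0\<close> whenever \<open>i\<close> does not weakly
  prefer \<open>j'\<close> to \<open>j\<close>. So it suffices to round \<open>x\<close> to an integral matrix without increasing the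
  cost, rounding each entry and each column sum up or down and keeping the row sums. An additional
  row holding the negated column sums makes all row and column sums of the matrix integral. Then
  each row and column that contains a fractional entry contains at least two, so there are at
  least as many fractional entries as such rows and columns together. As one of the corresponding
  sum equations is redundant, some nonzero matrix supported on the fractional entries has
  vanishing row and column sums. Moving along it in the direction of nonincreasing cost makes one
  more entry integral.\<close>

section \<open>Rounding a matrix\<close>

text \<open>Gaussian elimination, by induction on the equations. An equation whose coefficients all
  vanish is dropped; otherwise a pivot removes one equation together with one unknown, so the strict
  inequality between the cardinalities survives.\<close>

lemma underdetermined_homogeneous_system:
  fixes a :: "'e \<Rightarrow> 'f \<Rightarrow> 'k::field"
  assumes "finite E" "finite F" "card E < card F"
  shows "\<exists>d. (\<exists>f\<in>F. d f \<noteq> 0) \<and> (\<forall>e\<in>E. (\<Sum>f\<in>F. a e f * d f) = 0)"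
  using assms
proof (induction E arbitrary: F a rule: finite_induct)
  case empty
  then have "F \<noteq> {}" by auto
  then show ?case by (intro exI[of _ "\<lambda>_. 1"]) auto
next
  case (insert e E)
  show ?case
  proof (cases "\<forall>f\<in>F. a e f = 0")
    case True
    have "card E < card F" using insert by simp
    then obtain d where d: "\<exists>f\<in>F. d f \<noteq> 0" "\<forall>e\<in>E. (\<Sum>f\<in>F. a e f * d f) = 0"
      using insert.IH[of F a] insert.prems by blast
    moreover have "(\<Sum>f\<in>F. a e f * d f) = 0" using True by (intro sum.neutral) simp
    ultimately show ?thesis by (intro exI[of _ d]) simp
  next
    case False
    then obtain g where g: "g \<in> F" "a e g \<noteq> 0" by blast
    define G where "G = F - {g}"
    \<comment> \<open>Coefficients of equation \<open>e'\<close> after the unknown \<open>g\<close>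
      has been eliminated by means of equation \<open>e\<close>.\<close>
    define b where "b = (\<lambda>e' f. a e' f - a e' g * a e f / a e g)"
    have "card E < card G" "finite G" using insert g by (auto simp: G_def)
    then obtain d where d: "\<exists>f\<in>G. d f \<noteq> 0" "\<forall>e\<in>E. (\<Sum>f\<in>G. b e f * d f) = 0"
      using insert.IH[of G b] by blast
    \<comment> \<open>Back substitution: the value at \<open>g\<close> is the one that equation
      \<open>e\<close> forces.\<close>
    define d' where "d' = d(g := - (\<Sum>f\<in>G. a e f * d f) / a e g)"
    have split: "(\<Sum>f\<in>F. a e' f * d' f)
        = - a e' g * (\<Sum>f\<in>G. a e f * d f) / a e g + (\<Sum>f\<in>G. a e' f * d f)" for e'
    proof -
      have "(\<Sum>f\<in>F. a e' f * d' f) = a e' g * d' g + (\<Sum>f\<in>G. a e' f * d' f)"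
        using insert.prems g by (simp add: G_def sum.remove)
      also have "(\<Sum>f\<in>G. a e' f * d' f) = (\<Sum>f\<in>G. a e' f * d f)"
        by (intro sum.cong) (auto simp: G_def d'_def)
      finally show ?thesis by (simp add: d'_def)
    qed
    have "(\<Sum>f\<in>F. a e' f * d' f) = (\<Sum>f\<in>G. b e' f * d f)" for e'
      unfolding split b_def
      by (simp add: algebra_simps sum_subtractf sum_distrib_left sum_divide_distrib sum_negf)
    then have "\<forall>e'\<in>E. (\<Sum>f\<in>F. a e' f * d' f) = 0" using d by simp
    moreover have "(\<Sum>f\<in>F. a e f * d' f) = 0" unfolding split using g by simp
    moreover have "\<exists>f\<in>F. d' f \<noteq> 0" using d by (auto simp: G_def d'_def)
    ultimately show ?thesis by (intro exI[of _ d']) simp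
  qed
qed

section \<open>Counting fractional entries and finding a direction\<close>

lemma another_fractional_summand:
  fixes f :: "'a \<Rightarrow> real"
  assumes "finite A" "sum f A \<in> \<int>" "k \<in> A" "f k \<notin> \<int>"
  shows "\<exists>l\<in>A. l \<noteq> k \<and> f l \<notin> \<int>"
proof (rule ccontr)
  assume "\<not> ?thesis"
  then have "sum f (A - {k}) \<in> \<int>" by (intro Ints_sum) auto
  moreover have "f k = sum f A - sum f (A - {k})" using assms by (simp add: sum.remove)
  ultimately show False using assms by (metis Ints_diff)
qed

text \<open>Every fibre of \<open>h\<close> over the image has at least two elements, and the fibres
  partition \<open>F\<close>. With \<open>fst\<close> and \<open>snd\<close> for \<open>h\<close>,
  this bounds the number of rows and of columns that meet the set of fractional entries.\<close>

lemma card_ge_two_times_image: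
  assumes "finite F" and twins: "\<And>z. z \<in> F \<Longrightarrow> \<exists>w\<in>F. w \<noteq> z \<and> h w = h z"
  shows "2 * card (h ` F) \<le> card F"
proof -
  have "2 \<le> card {z\<in>F. h z = y}" if "y \<in> h ` F" for y
  proof -
    obtain z where z: "z \<in> F" "h z = y" using \<open>y \<in> h ` F\<close> by auto
    with twins obtain w where w: "w \<in> F" "w \<noteq> z" "h w = y" by metis
    have "card {z, w} \<le> card {z\<in>F. h z = y}"
      using z w assms(1) by (intro card_mono) auto
    with w show ?thesis by simp
  qed
  then have "(\<Sum>y\<in>h ` F. 2) \<le> (\<Sum>y\<in>h ` F. card {z\<in>F. h z = y})" by (intro sum_mono)
  also have "\<dots> = (\<Sum>y\<in>h ` F. \<Sum>z\<in>{z\<in>F. h z = y}. 1)" by simp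
  also have "\<dots> = (\<Sum>z\<in>F. 1)" by (rule sum.image_gen[symmetric, OF assms(1)])
  finally show ?thesis by simp
qed

lemma zero_sum_direction:
  fixes a :: "'r \<times> 'c \<Rightarrow> real"
  assumes fin: "finite R" "finite C"
    and rows: "\<forall>r\<in>R. (\<Sum>c\<in>C. a (r, c)) \<in> \<int>"
    and cols: "\<forall>c\<in>C. (\<Sum>r\<in>R. a (r, c)) \<in> \<int>"
    and frac: "\<exists>z\<in>R \<times> C. a z \<notin> \<int>"
  obtains d :: "'r \<times> 'c \<Rightarrow> real"
  where "\<exists>z\<in>R \<times> C. d z \<noteq> 0" and "\<forall>z\<in>R \<times> C. d z \<noteq> 0 \<longrightarrow> a z \<notin> \<int>"
    and "\<forall>r\<in>R. (\<Sum>c\<in>C. d (r, c)) = 0" and "\<forall>c\<in>C. (\<Sum>r\<in>R. d (r, c)) = 0"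
proof -
  define F where "F = {z\<in>R \<times> C. a z \<notin> \<int>}"
  have finF: "finite F" using fin by (simp add: F_def)
  obtain r0 c0 where r0c0: "(r0, c0) \<in> F" using frac by (auto simp: F_def)
  have "\<exists>w\<in>F. w \<noteq> z \<and> fst w = fst z" if "z \<in> F" for z
  proof -
    obtain r c where z: "z = (r, c)" "r \<in> R" "c \<in> C" "a (r, c) \<notin> \<int>"
      using \<open>z \<in> F\<close> by (auto simp: F_def)
    then obtain l where "l \<in> C" "l \<noteq> c" "a (r, l) \<notin> \<int>"
      using another_fractional_summand[OF fin(2) bspec[OF rows]] by blast
    with z show ?thesis by (intro bexI[of _ "(r, l)"]) (auto simp: F_def)
  qed
  from card_ge_two_times_image[OF finF this] have cardR: "2 * card (fst ` F) \<le> card F" .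
  have "\<exists>w\<in>F. w \<noteq> z \<and> snd w = snd z" if "z \<in> F" for z
  proof -
    obtain r c where z: "z = (r, c)" "r \<in> R" "c \<in> C" "a (r, c) \<notin> \<int>"
      using \<open>z \<in> F\<close> by (auto simp: F_def)
    then obtain l where "l \<in> R" "l \<noteq> r" "a (l, c) \<notin> \<int>"
      using another_fractional_summand[OF fin(1) bspec[OF cols]] by blast
    with z show ?thesis by (intro bexI[of _ "(l, c)"]) (auto simp: F_def)
  qed
  from card_ge_two_times_image[OF finF this] have cardC: "2 * card (snd ` F) \<le> card F" .

  \<comment> \<open>One equation for each row and column that meets \<open>F\<close>, except for row
    \<open>r0\<close>. Rows and columns number at most \<open>card F\<close> together, so the
    omission makes the system underdetermined.\<close>
  define E where "E = Inl ` (fst ` F - {r0}) \<union> Inr ` (snd ` F)"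
  define m :: "'r + 'c \<Rightarrow> 'r \<times> 'c \<Rightarrow> real" where
    "m = (\<lambda>e z. case e of Inl r \<Rightarrow> of_bool (fst z = r) | Inr c \<Rightarrow> of_bool (snd z = c))"
  have "card E = card (fst ` F - {r0}) + card (snd ` F)"
    unfolding E_def using finF by (subst card_Un_disjoint) (auto simp: card_image)
  moreover have "card (fst ` F - {r0}) < card (fst ` F)"
    using finF r0c0 by (intro card_Diff1_less) force+
  ultimately have "card E < card F" using cardR cardC by linarith
  moreover have "finite E" using finF by (simp add: E_def)
  ultimately obtain d0 where d0: "\<exists>z\<in>F. d0 z \<noteq> 0" "\<forall>e\<in>E. (\<Sum>z\<in>F. m e z * d0 z) = 0"
    using underdetermined_homogeneous_system[OF _ finF, of E m] by blast
  \<comment> \<open>Extension by zero makes the sums over \<open>F\<close> sums over full rows and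
    columns, and rows or columns that miss \<open>F\<close> get the sum zero for free.\<close>
  define d where "d = (\<lambda>z. if z \<in> F then d0 z else 0)"
  have to_F: "(\<Sum>z\<in>F. m e z * d0 z) = (\<Sum>z\<in>R \<times> C. m e z * d z)" for e
    using fin by (intro sum.mono_neutral_cong_left) (auto simp: F_def d_def)
  have row_sum: "(\<Sum>c\<in>C. d (r, c)) = (\<Sum>z\<in>F. m (Inl r) z * d0 z)" if "r \<in> R" for r
  proof -
    have "(\<Sum>z\<in>R \<times> C. m (Inl r) z * d z) = (\<Sum>r'\<in>R. \<Sum>c\<in>C. of_bool (r' = r) * d (r', c))"
      by (simp add: m_def sum.cartesian_product split_beta)
    also have "\<dots> = (\<Sum>r'\<in>R. if r' = r then (\<Sum>c\<in>C. d (r', c)) else 0)"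
      by (intro sum.cong) auto
    finally show ?thesis using that fin by (simp add: to_F)
  qed
  have col_sum: "(\<Sum>r\<in>R. d (r, c)) = (\<Sum>z\<in>F. m (Inr c) z * d0 z)" if "c \<in> C" for c
  proof -
    have "(\<Sum>z\<in>R \<times> C. m (Inr c) z * d z) = (\<Sum>r\<in>R. \<Sum>c'\<in>C. of_bool (c' = c) * d (r, c'))"
      by (simp add: m_def sum.cartesian_product split_beta)
    also have "\<dots> = (\<Sum>r\<in>R. \<Sum>c'\<in>C. if c' = c then d (r, c') else 0)"
      by (intro sum.cong) auto
    finally show ?thesis using that fin by (simp add: to_F)
  qed
  have cols0: "(\<Sum>r\<in>R. d (r, c)) = 0" if "c \<in> C" for c
  proof (cases "c \<in> snd ` F")
    case True
    then show ?thesis using d0 that by (simp add: col_sum E_def)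
  next
    case False
    then have "(r, c) \<notin> F" for r by force
    then show ?thesis by (simp add: d_def)
  qed
  have rows0': "(\<Sum>c\<in>C. d (r, c)) = 0" if "r \<in> R" "r \<noteq> r0" for r
  proof (cases "r \<in> fst ` F")
    case True
    then show ?thesis using d0 that by (simp add: row_sum E_def)
  next
    case False
    then have "(r, c) \<notin> F" for c by force
    then show ?thesis by (simp add: d_def)
  qed
  have r0: "r0 \<in> R" using r0c0 by (simp add: F_def)
  \<comment> \<open>The omitted equation is recovered by summing all entries in two ways: all
    columns and all rows but \<open>r0\<close> contribute zero.\<close>
  have "0 = (\<Sum>c\<in>C. \<Sum>r\<in>R. d (r, c))" using cols0 by simp
  also have "\<dots> = (\<Sum>r\<in>R. \<Sum>c\<in>C. d (r, c))" by (rule sum.swap)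
  also have "\<dots> = (\<Sum>c\<in>C. d (r0, c))"
    using fin r0 rows0' by (simp add: sum.remove)
  finally have "\<forall>r\<in>R. (\<Sum>c\<in>C. d (r, c)) = 0" using rows0' by metis
  moreover have "\<exists>z\<in>R \<times> C. d z \<noteq> 0" using d0(1) by (auto simp: d_def F_def)
  moreover have "\<forall>z\<in>R \<times> C. d z \<noteq> 0 \<longrightarrow> a z \<notin> \<int>" by (auto simp: d_def F_def)
  moreover have "\<forall>c\<in>C. (\<Sum>r\<in>R. d (r, c)) = 0" using cols0 by (rule ballI)
  ultimately show thesis by (intro that)
qed

section \<open>Rounding by moves along a direction\<close>

text \<open>Move from \<open>a\<close> along \<open>d\<close> until the first entry reaches the next
  integer on its way. At that moment no other entry has passed its own floor or ceiling.\<close>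

lemma rounding_step:
  fixes a d :: "'a \<Rightarrow> real"
  assumes "finite S" and nz: "\<exists>z\<in>S. d z \<noteq> 0"
    and frac: "\<And>z. z \<in> S \<Longrightarrow> d z \<noteq> 0 \<Longrightarrow> a z \<notin> \<int>"
  obtains t z0 where "t \<ge> 0"
    and "\<forall>z\<in>S. of_int \<lfloor>a z\<rfloor> \<le> a z + t * d z \<and> a z + t * d z \<le> of_int \<lceil>a z\<rceil>"
    and "z0 \<in> S" and "a z0 \<notin> \<int>" and "a z0 + t * d z0 \<in> \<int>"
proof -
  define D where "D = {z\<in>S. d z \<noteq> 0}"
  \<comment> \<open>The step length at which entry \<open>z\<close> reaches its ceiling if it grows,
    its floor if it decreases.\<close>
  define \<tau> where
    "\<tau> = (\<lambda>z. if d z > 0 then (of_int \<lceil>a z\<rceil> - a z) / d z else (of_int \<lfloor>a z\<rfloor> - a z) / d z)"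
  have D: "finite D" "D \<noteq> {}" using assms by (auto simp: D_def)
  define t where "t = Min (\<tau> ` D)"
  have "t \<in> \<tau> ` D" using D by (simp add: t_def)
  then obtain z0 where z0: "z0 \<in> D" "t = \<tau> z0" by auto
  have t_le: "t \<le> \<tau> z" if "z \<in> D" for z using that D by (simp add: t_def)
  \<comment> \<open>This includes entries with \<open>d z = 0\<close>, where division by zero yields
    0.\<close>
  have "0 \<le> \<tau> z" for z
    by (auto simp: \<tau>_def zero_le_divide_iff)
  then have t0: "0 \<le> t" using z0 by simp
  have bounds: "of_int \<lfloor>a z\<rfloor> \<le> a z + t * d z \<and> a z + t * d z \<le> of_int \<lceil>a z\<rceil>" if "z \<in> S" for z
  proof (cases "d z" "0::real" rule: linorder_cases)
    case less
    then have "t \<le> (of_int \<lfloor>a z\<rfloor> - a z) / d z" using t_le[of z] that by (simp add: D_def \<tau>_def)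
    then have "of_int \<lfloor>a z\<rfloor> - a z \<le> t * d z" using less by (simp add: neg_le_divide_eq)
    moreover have "t * d z \<le> 0" using t0 less by (simp add: mult_nonneg_nonpos)
    ultimately show ?thesis using le_of_int_ceiling[of "a z"] by linarith
  next
    case equal
    then show ?thesis by simp
  next
    case greater
    then have "t \<le> (of_int \<lceil>a z\<rceil> - a z) / d z" using t_le[of z] that by (simp add: D_def \<tau>_def)
    then have "t * d z \<le> of_int \<lceil>a z\<rceil> - a z" using greater by (simp add: pos_le_divide_eq)
    moreover have "0 \<le> t * d z" using t0 greater by simp
    ultimately show ?thesis using of_int_floor_le[of "a z"] by linarith
  qed
  have "a z0 + t * d z0 \<in> \<int>"
    using z0 by (auto simp: \<tau>_def D_def)
  moreover have "a z0 \<notin> \<int>" "z0 \<in> S" using z0 frac by (auto simp: D_def)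
  moreover have "\<forall>z\<in>S. of_int \<lfloor>a z\<rfloor> \<le> a z + t * d z \<and> a z + t * d z \<le> of_int \<lceil>a z\<rceil>"
    using bounds by (rule ballI)
  ultimately show thesis using t0 by (intro that)
qed

text \<open>Induction on the number of fractional entries: a move leaves integral entries alone and
  makes at least one fractional entry integral.\<close>

lemma matrix_rounding:
  fixes a w :: "'r \<times> 'c \<Rightarrow> real"
  assumes fin: "finite R" "finite C"
    and "\<forall>r\<in>R. (\<Sum>c\<in>C. a (r, c)) \<in> \<int>"
    and "\<forall>c\<in>C. (\<Sum>r\<in>R. a (r, c)) \<in> \<int>"
  shows "\<exists>b. (\<forall>z\<in>R \<times> C. b z \<in> \<int> \<and> of_int \<lfloor>a z\<rfloor> \<le> b z \<and> b z \<le> of_int \<lceil>a z\<rceil>) \<and>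
    (\<forall>r\<in>R. (\<Sum>c\<in>C. b (r, c)) = (\<Sum>c\<in>C. a (r, c))) \<and>
    (\<forall>c\<in>C. (\<Sum>r\<in>R. b (r, c)) = (\<Sum>r\<in>R. a (r, c))) \<and>
    (\<Sum>z\<in>R \<times> C. w z * b z) \<le> (\<Sum>z\<in>R \<times> C. w z * a z)"
  using assms(3,4)
proof (induction "card {z\<in>R \<times> C. a z \<notin> \<int>}" arbitrary: a rule: less_induct)
  case less
  have finRC: "finite (R \<times> C)" using fin by simp
  show ?case
  proof (cases "\<exists>z\<in>R \<times> C. a z \<notin> \<int>")
    case False
    then show ?thesis by (intro exI[of _ a]) auto
  next
    case True
    obtain d1 :: "'r \<times> 'c \<Rightarrow> real" where d1: "\<exists>z\<in>R \<times> C. d1 z \<noteq> 0" "\<forall>z\<in>R \<times> C. d1 z \<noteq> 0 \<longrightarrow> a z \<notin> \<int>"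
      "\<forall>r\<in>R. (\<Sum>c\<in>C. d1 (r, c)) = 0" "\<forall>c\<in>C. (\<Sum>r\<in>R. d1 (r, c)) = 0"
      by (rule zero_sum_direction[OF fin less.prems True])
    define q where "q = (\<Sum>z\<in>R \<times> C. w z * d1 z)"
    \<comment> \<open>The conditions on a direction are invariant under negation, so the sign can be
      chosen such that the cost does not increase.\<close>
    define \<sigma> :: real where "\<sigma> = (if q \<le> 0 then 1 else - 1)"
    define d where "d = (\<lambda>z. \<sigma> * d1 z)"
    have "\<sigma> \<noteq> 0" by (simp add: \<sigma>_def)
    then have d: "\<exists>z\<in>R \<times> C. d z \<noteq> 0" "\<And>z. z \<in> R \<times> C \<Longrightarrow> d z \<noteq> 0 \<Longrightarrow> a z \<notin> \<int>"
      using d1(1,2) by (auto simp: d_def)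
    have d_rows: "(\<Sum>c\<in>C. d (r, c)) = 0" if "r \<in> R" for r
      using d1(3) that by (simp add: d_def flip: sum_distrib_left)
    have d_cols: "(\<Sum>r\<in>R. d (r, c)) = 0" if "c \<in> C" for c
      using d1(4) that by (simp add: d_def flip: sum_distrib_left)
    have "(\<Sum>z\<in>R \<times> C. w z * d z) = \<sigma> * q"
      by (simp add: d_def q_def sum_distrib_left algebra_simps)
    also have "\<sigma> * q \<le> 0" by (simp add: \<sigma>_def)
    finally have d_cost: "(\<Sum>z\<in>R \<times> C. w z * d z) \<le> 0" .
    obtain t z0 where t: "t \<ge> 0"
      "\<forall>z\<in>R \<times> C. of_int \<lfloor>a z\<rfloor> \<le> a z + t * d z \<and> a z + t * d z \<le> of_int \<lceil>a z\<rceil>"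
      and z0: "z0 \<in> R \<times> C" "a z0 \<notin> \<int>" "a z0 + t * d z0 \<in> \<int>"
      by (rule rounding_step[OF finRC d])
    define a' where "a' = (\<lambda>z. a z + t * d z)"
    have rows: "(\<Sum>c\<in>C. a' (r, c)) = (\<Sum>c\<in>C. a (r, c))" if "r \<in> R" for r
      using d_rows[OF that] by (simp add: a'_def sum.distrib flip: sum_distrib_left)
    have cols: "(\<Sum>r\<in>R. a' (r, c)) = (\<Sum>r\<in>R. a (r, c))" if "c \<in> C" for c
      using d_cols[OF that] by (simp add: a'_def sum.distrib flip: sum_distrib_left)
    have "a' z = a z" if "z \<in> R \<times> C" "a z \<in> \<int>" for z
      using d(2)[OF that(1)] that(2) by (auto simp: a'_def)
    then have "{z\<in>R \<times> C. a' z \<notin> \<int>} \<subseteq> {z\<in>R \<times> C. a z \<notin> \<int>}" by auto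
    moreover have "z0 \<in> {z\<in>R \<times> C. a z \<notin> \<int>} - {z\<in>R \<times> C. a' z \<notin> \<int>}"
      using z0 by (simp add: a'_def)
    ultimately have "{z\<in>R \<times> C. a' z \<notin> \<int>} \<subset> {z\<in>R \<times> C. a z \<notin> \<int>}" by blast
    then have fewer: "card {z\<in>R \<times> C. a' z \<notin> \<int>} < card {z\<in>R \<times> C. a z \<notin> \<int>}"
      using finRC by (intro psubset_card_mono) auto
    have "\<forall>r\<in>R. (\<Sum>c\<in>C. a' (r, c)) \<in> \<int>" "\<forall>c\<in>C. (\<Sum>r\<in>R. a' (r, c)) \<in> \<int>"
      using rows cols less.prems by simp_all
    from less.hyps[OF fewer this] obtain b where
      b: "\<forall>z\<in>R \<times> C. b z \<in> \<int> \<and> of_int \<lfloor>a' z\<rfloor> \<le> b z \<and> b z \<le> of_int \<lceil>a' z\<rceil>"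
      "\<forall>r\<in>R. (\<Sum>c\<in>C. b (r, c)) = (\<Sum>c\<in>C. a' (r, c))"
      "\<forall>c\<in>C. (\<Sum>r\<in>R. b (r, c)) = (\<Sum>r\<in>R. a' (r, c))"
      "(\<Sum>z\<in>R \<times> C. w z * b z) \<le> (\<Sum>z\<in>R \<times> C. w z * a' z)"
      by (elim exE conjE) (rule that)
    \<comment> \<open>The moved entry stays between the floor and the ceiling of the old one, so the
      new rounding interval lies inside the old one.\<close>
    have bnd: "of_int \<lfloor>a z\<rfloor> \<le> b z \<and> b z \<le> of_int \<lceil>a z\<rceil>" if "z \<in> R \<times> C" for z
    proof -
      have "of_int \<lfloor>a z\<rfloor> \<le> a' z" "a' z \<le> of_int \<lceil>a z\<rceil>"
        using bspec[OF t(2) that] by (simp_all add: a'_def)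
      then have "\<lfloor>a z\<rfloor> \<le> \<lfloor>a' z\<rfloor>" "\<lceil>a' z\<rceil> \<le> \<lceil>a z\<rceil>" by (simp_all add: le_floor_iff ceiling_le_iff)
      then have "real_of_int \<lfloor>a z\<rfloor> \<le> of_int \<lfloor>a' z\<rfloor>" "real_of_int \<lceil>a' z\<rceil> \<le> of_int \<lceil>a z\<rceil>" by simp_all
      with b(1) that show ?thesis by (meson order_trans)
    qed
    have "(\<Sum>z\<in>R \<times> C. w z * a' z) = (\<Sum>z\<in>R \<times> C. w z * a z) + t * (\<Sum>z\<in>R \<times> C. w z * d z)"
      by (simp add: a'_def algebra_simps sum.distrib sum_distrib_left)
    moreover have "t * (\<Sum>z\<in>R \<times> C. w z * d z) \<le> 0" using t(1) d_cost by (rule mult_nonneg_nonpos)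
    ultimately have "(\<Sum>z\<in>R \<times> C. w z * b z) \<le> (\<Sum>z\<in>R \<times> C. w z * a z)" using b(4) by linarith
    then show ?thesis using b bnd rows cols by (intro exI[of _ b]) simp
  qed
qed

section \<open>Assignments with fractional column sums\<close>

text \<open>The column sums of \<open>x\<close> may be fractional, so they become entries of an
  extended matrix and are rounded like the others. Zero entries stay zero because 0 is its own floor
  and ceiling; this preserves constraints that force entries to vanish.\<close>

lemma assignment_rounding:
  fixes x g :: "'i \<Rightarrow> 'j \<Rightarrow> real"
  assumes fin: "finite I" "finite J"
    and rows: "\<forall>i\<in>I. (\<Sum>j\<in>J. x i j) = 1"
    and box: "\<forall>i\<in>I. \<forall>j\<in>J. 0 \<le> x i j \<and> x i j \<le> 1"
  shows "\<exists>x'. (\<forall>i\<in>I. \<forall>j\<in>J. x' i j \<in> {0, 1} \<and> (x i j = 0 \<longrightarrow> x' i j = 0)) \<and>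
    (\<forall>i\<in>I. (\<Sum>j\<in>J. x' i j) = 1) \<and>
    (\<forall>j\<in>J. of_int \<lfloor>\<Sum>i\<in>I. x i j\<rfloor> \<le> (\<Sum>i\<in>I. x' i j) \<and>
            (\<Sum>i\<in>I. x' i j) \<le> of_int \<lceil>\<Sum>i\<in>I. x i j\<rceil>) \<and>
    (\<Sum>i\<in>I. \<Sum>j\<in>J. g i j * x' i j) \<le> (\<Sum>i\<in>I. \<Sum>j\<in>J. g i j * x i j)"
proof -
  \<comment> \<open>\<open>None\<close> indexes the additional row; \<open>w\<close> gives it cost
    zero, so the cost of the extended matrix is that of \<open>x\<close>.\<close>
  define R where "R = insert None (Some ` I)"
  define a where "a = (\<lambda>(r, j). case r of None \<Rightarrow> - (\<Sum>i\<in>I. x i j) | Some i \<Rightarrow> x i j)"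
  define w where "w = (\<lambda>(r, j). case r of None \<Rightarrow> 0 | Some i \<Rightarrow> g i j)"
  have finR: "finite R" using fin by (simp add: R_def)
  have sumR: "sum h R = h None + (\<Sum>i\<in>I. h (Some i))" for h :: "'i option \<Rightarrow> real"
    using fin by (simp add: R_def sum.reindex)
  \<comment> \<open>Each row of \<open>x\<close> sums to 1, so the total of all column sums is the
    integer \<open>card I\<close>.\<close>
  have None_row: "(\<Sum>j\<in>J. a (None, j)) = - real (card I)"
  proof -
    have "(\<Sum>j\<in>J. a (None, j)) = - (\<Sum>j\<in>J. \<Sum>i\<in>I. x i j)" by (simp add: a_def sum_negf)
    also have "(\<Sum>j\<in>J. \<Sum>i\<in>I. x i j) = (\<Sum>i\<in>I. \<Sum>j\<in>J. x i j)" by (rule sum.swap)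
    finally show ?thesis using rows by simp
  qed
  have Some_row: "(\<Sum>j\<in>J. a (Some i, j)) = 1" if "i \<in> I" for i
    using rows that by (simp add: a_def)
  have cols_a: "(\<Sum>r\<in>R. a (r, j)) = 0" for j
    by (simp add: sumR) (simp add: a_def)
  have "\<forall>r\<in>R. (\<Sum>j\<in>J. a (r, j)) \<in> \<int>" "\<forall>j\<in>J. (\<Sum>r\<in>R. a (r, j)) \<in> \<int>"
    by (simp_all add: R_def None_row Some_row) (simp add: cols_a flip: R_def)
  from matrix_rounding[OF finR fin(2) this] obtain b where
    b: "\<forall>z\<in>R \<times> J. b z \<in> \<int> \<and> of_int \<lfloor>a z\<rfloor> \<le> b z \<and> b z \<le> of_int \<lceil>a z\<rceil>"
    "\<forall>r\<in>R. (\<Sum>j\<in>J. b (r, j)) = (\<Sum>j\<in>J. a (r, j))"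
    "\<forall>j\<in>J. (\<Sum>r\<in>R. b (r, j)) = (\<Sum>r\<in>R. a (r, j))"
    "(\<Sum>z\<in>R \<times> J. w z * b z) \<le> (\<Sum>z\<in>R \<times> J. w z * a z)"
    by blast
  define x' where "x' = (\<lambda>i j. b (Some i, j))"
  have entry: "x' i j \<in> {0, 1} \<and> (x i j = 0 \<longrightarrow> x' i j = 0)" if "i \<in> I" "j \<in> J" for i j
  proof -
    have bij: "x' i j \<in> \<int>" "of_int \<lfloor>x i j\<rfloor> \<le> x' i j" "x' i j \<le> of_int \<lceil>x i j\<rceil>"
      using b(1) that by (auto simp: R_def x'_def a_def)
    have "0 \<le> \<lfloor>x i j\<rfloor>" "\<lceil>x i j\<rceil> \<le> 1"
      using box that by (simp_all add: ceiling_le_iff)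
    then have "0 \<le> real_of_int \<lfloor>x i j\<rfloor>" "real_of_int \<lceil>x i j\<rceil> \<le> 1" by simp_all
    with bij have 01: "0 \<le> x' i j" "x' i j \<le> 1" by linarith+
    obtain k where k: "x' i j = of_int k" using bij(1) by (auto elim: Ints_cases)
    with 01 have "0 \<le> k" "k \<le> 1" by simp_all
    then have "k = 0 \<or> k = 1" by linarith
    then have "x' i j \<in> {0, 1}" using k by auto
    moreover have "x' i j = 0" if "x i j = 0" using bij(2,3) that by simp
    ultimately show ?thesis by blast
  qed
  have "(\<Sum>j\<in>J. x' i j) = 1" if "i \<in> I" for i
    using b(2) that rows by (auto simp: R_def x'_def a_def)
  moreover have "of_int \<lfloor>\<Sum>i\<in>I. x i j\<rfloor> \<le> (\<Sum>i\<in>I. x' i j) \<and>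
      (\<Sum>i\<in>I. x' i j) \<le> of_int \<lceil>\<Sum>i\<in>I. x i j\<rceil>" if "j \<in> J" for j
  proof -
    \<comment> \<open>The columns of \<open>b\<close> still sum to zero, so the bounds on the entry
      in row \<open>None\<close> become bounds on the column sum; negation swaps floor and
      ceiling.\<close>
    have "(\<Sum>i\<in>I. x' i j) = - b (None, j)"
      using b(3) that by (simp add: cols_a sumR x'_def eq_neg_iff_add_eq_0 add.commute)
    moreover have "of_int \<lfloor>- (\<Sum>i\<in>I. x i j)\<rfloor> \<le> b (None, j)" "b (None, j) \<le> of_int \<lceil>- (\<Sum>i\<in>I. x i j)\<rceil>"
      using b(1) that by (auto simp: R_def a_def)
    ultimately show ?thesis by (simp add: floor_minus ceiling_minus)
  qed
  moreover have "(\<Sum>i\<in>I. \<Sum>j\<in>J. g i j * x' i j) \<le> (\<Sum>i\<in>I. \<Sum>j\<in>J. g i j * x i j)"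
  proof -
    have "(\<Sum>z\<in>R \<times> J. w z * h z) = (\<Sum>i\<in>I. \<Sum>j\<in>J. g i j * h (Some i, j))" for h
    proof -
      have "(\<Sum>z\<in>R \<times> J. w z * h z) = (\<Sum>r\<in>R. \<Sum>j\<in>J. w (r, j) * h (r, j))"
        by (simp add: sum.cartesian_product)
      then show ?thesis by (simp add: sumR w_def)
    qed
    with b(4) show ?thesis by (simp add: x'_def a_def)
  qed
  ultimately show ?thesis using entry by (intro exI[of _ x']) blast
qed

section \<open>The two models\<close>

lemma relaxed_point_rounding:
  fixes P :: "('i, 'j) cflcp"
  assumes P: "cflcp_instance P" and s: "s \<in> relaxed_feasible_set P"
  shows "\<exists>s'\<in>original_feasible_set P. objective P s' \<le> objective P s"
proof -
  obtain x y u v where s_eq: "s = (x, y, u, v)" by (metis prod_cases4)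
  define I J where "I = customers P" and "J = plants P"
  note defs = I_def J_def
  have fin: "finite I" "finite J" using P by (auto simp: cflcp_instance_def defs)
  \<comment> \<open>Needed because \<open>v\<close> is binary only off the diagonal.\<close>
  have irrefl: "j \<noteq> j'" if "i \<in> I" "j \<in> J" "prefers P i j j'" for i j j'
    using P that by (auto simp: cflcp_instance_def strict_total_order_on_def irreflp_on_def defs)
  have lin:
    "\<And>i. i \<in> I \<Longrightarrow> (\<Sum>j\<in>J. x i j) = 1"
    "\<And>j. j \<in> J \<Longrightarrow> (\<Sum>i\<in>I. x i j) \<le> (real (capacity P j) - 1) * y j + u j"
    "\<And>j. j \<in> J \<Longrightarrow> real (capacity P j) * u j \<le> (\<Sum>i\<in>I. x i j)"
    "\<And>i j. i \<in> I \<Longrightarrow> j \<in> J \<Longrightarrow> x i j \<le> y j"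
    "\<And>i j. i \<in> I \<Longrightarrow> j \<in> J \<Longrightarrow> y j \<le> u j + (\<Sum>j'\<in>{j'\<in>J. weakly_prefers P i j' j}. x i j')"
    "\<And>i j j'. i \<in> I \<Longrightarrow> j \<in> J \<Longrightarrow> j' \<in> J \<Longrightarrow> prefers P i j j' \<Longrightarrow> x i j' \<le> v j j'"
    and v_sum: "\<forall>j\<in>J. \<forall>j'\<in>J. j \<noteq> j' \<longrightarrow> v j j' + v j' j \<le> 1"
    and box: "\<And>i j. i \<in> I \<Longrightarrow> j \<in> J \<Longrightarrow> 0 \<le> x i j \<and> x i j \<le> 1"
    and uy: "\<And>j. j \<in> J \<Longrightarrow> u j \<in> {0, 1} \<and> y j \<in> {0, 1}"
    and v: "\<And>j j'. j \<in> J \<Longrightarrow> j' \<in> J \<Longrightarrow> j \<noteq> j' \<Longrightarrow> v j j' \<in> {0, 1}"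
    and bin: "binary_yuv P (x, y, u, v)"
    using s by (auto simp: relaxed_feasible_set_def s_eq defs)
  have "\<forall>i\<in>I. (\<Sum>j\<in>J. x i j) = 1" "\<forall>i\<in>I. \<forall>j\<in>J. 0 \<le> x i j \<and> x i j \<le> 1"
    using lin(1) box by blast+
  from assignment_rounding[OF fin this, of "allocation_cost P"] obtain x' where
    x': "\<And>i j. i \<in> I \<Longrightarrow> j \<in> J \<Longrightarrow> x' i j \<in> {0, 1}"
    and zero: "\<And>i j. i \<in> I \<Longrightarrow> j \<in> J \<Longrightarrow> x i j = 0 \<Longrightarrow> x' i j = 0"
    and rows: "\<And>i. i \<in> I \<Longrightarrow> (\<Sum>j\<in>J. x' i j) = 1"
    and cols: "\<And>j. j \<in> J \<Longrightarrow> of_int \<lfloor>\<Sum>i\<in>I. x i j\<rfloor> \<le> (\<Sum>i\<in>I. x' i j)"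
      "\<And>j. j \<in> J \<Longrightarrow> (\<Sum>i\<in>I. x' i j) \<le> of_int \<lceil>\<Sum>i\<in>I. x i j\<rceil>"
    and cost: "(\<Sum>i\<in>I. \<Sum>j\<in>J. allocation_cost P i j * x' i j)
      \<le> (\<Sum>i\<in>I. \<Sum>j\<in>J. allocation_cost P i j * x i j)"
    by blast
  \<comment> \<open>A binary bound \<open>q\<close> is either 1, which every entry of
    \<open>x'\<close> respects, or 0, and then \<open>x i j\<close> vanishes and so does
    \<open>x' i j\<close>.\<close>
  have x'_bound: "x' i j \<le> q" if "i \<in> I" "j \<in> J" "x i j \<le> q" "q \<in> {0, 1}" for i j and q :: real
    using x'[OF that(1,2)] zero[OF that(1,2)] box[OF that(1,2)] that(3,4) by auto
  have col_upper: "(\<Sum>i\<in>I. x' i j) \<le> (real (capacity P j) - 1) * y j + u j" if "j \<in> J" for j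
  proof -
    \<comment> \<open>As \<open>y\<close> and \<open>u\<close> are binary, the bound is an integer
      and hence also bounds the ceiling of the column sum of \<open>x\<close>.\<close>
    have "(real (capacity P j) - 1) * y j + u j \<in> \<int>"
      using uy[OF that] by auto
    then obtain k where k: "(real (capacity P j) - 1) * y j + u j = of_int k"
      by (auto elim: Ints_cases)
    with lin(2)[OF that] have "\<lceil>\<Sum>i\<in>I. x i j\<rceil> \<le> k" by (simp add: ceiling_le_iff)
    then have "real_of_int \<lceil>\<Sum>i\<in>I. x i j\<rceil> \<le> of_int k" by simp
    with cols(2)[OF that] k show ?thesis by linarith
  qed
  have col_lower: "real (capacity P j) * u j \<le> (\<Sum>i\<in>I. x' i j)" if "j \<in> J" for j
  proof -
    have "real (capacity P j) * u j \<in> \<int>"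
      using uy[OF that] by auto
    then obtain k where k: "real (capacity P j) * u j = of_int k"
      by (auto elim: Ints_cases)
    with lin(3)[OF that] have "k \<le> \<lfloor>\<Sum>i\<in>I. x i j\<rfloor>" by (simp add: le_floor_iff)
    then have "of_int k \<le> real_of_int \<lfloor>\<Sum>i\<in>I. x i j\<rfloor>" by simp
    with cols(1)[OF that] k show ?thesis by linarith
  qed
  have pref: "y j \<le> u j + (\<Sum>j'\<in>{j'\<in>J. weakly_prefers P i j' j}. x' i j')"
    if ij: "i \<in> I" "j \<in> J" for i j
  proof -
    let ?W = "{j'\<in>J. weakly_prefers P i j' j}"
    have nonneg: "0 \<le> (\<Sum>j'\<in>?W. x' i j')"
      using x'[OF ij(1)] by (intro sum_nonneg) force
    \<comment> \<open>Unless \<open>y j = 1\<close> and \<open>u j = 0\<close>, already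
      \<open>y j\<close> is at most \<open>u j\<close>.\<close>
    show ?thesis
    proof (cases "y j = 1 \<and> u j = 0")
      case False
      then show ?thesis using uy[OF ij(2)] nonneg by auto
    next
      case True
      have split: "(\<Sum>j'\<in>J. h j') = (\<Sum>j'\<in>J - ?W. h j') + (\<Sum>j'\<in>?W. h j')" for h :: "'j \<Rightarrow> real"
        using fin by (intro sum.subset_diff) auto
      \<comment> \<open>The constraint puts at least 1 of the row sum 1 on \<open>?W\<close>. The
        nonnegative entries outside \<open>?W\<close> therefore vanish, rounding keeps them zero,
        and the whole row sum of \<open>x'\<close> lies on \<open>?W\<close>.\<close>
      have "(\<Sum>j'\<in>J - ?W. x i j') \<le> 0"
        using lin(5)[OF ij] True lin(1)[OF ij(1)] split[of "x i"] by simp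
      moreover have "\<And>j'. j' \<in> J - ?W \<Longrightarrow> 0 \<le> x i j'" using box ij by blast
      ultimately have "\<forall>j'\<in>J - ?W. x i j' = 0"
        using fin by (metis (no_types, lifting) finite_Diff order_antisym sum_nonneg sum_nonneg_eq_0_iff)
      then have "(\<Sum>j'\<in>J - ?W. x' i j') = 0" using zero[OF ij(1)] by (intro sum.neutral) simp
      then show ?thesis using split[of "x' i"] rows[OF ij(1)] True by simp
    qed
  qed
  have "linear_constraints P (x', y, u, v)"
    unfolding linear_constraints.simps defs[symmetric]
  proof (intro conjI ballI impI)
    fix i j j' assume "i \<in> I" "j \<in> J" "j' \<in> J" "prefers P i j j'"
    then show "x' i j' \<le> v j j'" using x'_bound[OF _ _ lin(6) v] irrefl by blast
  next
    fix i j assume "i \<in> I" "j \<in> J"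
    then show "x' i j \<le> y j" using x'_bound[OF _ _ lin(4)] uy by blast
  qed (use rows col_upper col_lower pref v_sum in auto)
  moreover have "binary_x P (x', y, u, v)" using x' by (simp add: defs)
  ultimately have "(x', y, u, v) \<in> original_feasible_set P"
    using bin by (simp add: original_feasible_set_def)
  moreover have "objective P (x', y, u, v) \<le> objective P s"
    using cost by (simp add: s_eq defs)
  ultimately show ?thesis by blast
qed

lemma original_subset_relaxed: "original_feasible_set P \<subseteq> relaxed_feasible_set P"
proof
  fix s assume s: "s \<in> original_feasible_set P"
  obtain x y u v where s_eq: "s = (x, y, u, v)" by (metis prod_cases4)
  have "relaxed_x P s" using s by (fastforce simp: s_eq original_feasible_set_def)
  then show "s \<in> relaxed_feasible_set P"
    using s by (simp add: original_feasible_set_def relaxed_feasible_set_def)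
qed

section \<open>Attainment of the minimum\<close>

text \<open>The objective depends only on the binary values of \<open>x\<close> and \<open>y\<close>
  on the index sets, that is, on the set of open plants and the set of allocated pairs. So it takes
  finitely many values, although the free values of a point may make the feasible set
  infinite.\<close>

lemma finite_original_objective:
  assumes "cflcp_instance P"
  shows "finite (objective P ` original_feasible_set P)"
proof -
  define I J where "I = customers P" and "J = plants P"
  have fin: "finite I" "finite J" using assms by (auto simp: cflcp_instance_def I_def J_def)
  define val where "val = (\<lambda>(Y, X). (\<Sum>j\<in>J. opening_cost P j * of_bool (j \<in> Y)) +
    (\<Sum>i\<in>I. \<Sum>j\<in>J. allocation_cost P i j * of_bool ((i, j) \<in> X)))"
  have "objective P s \<in> val ` (Pow J \<times> Pow (I \<times> J))" if "s \<in> original_feasible_set P" for s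
  proof -
    obtain x y u v where s_eq: "s = (x, y, u, v)" by (metis prod_cases4)
    have 01: "\<And>j. j \<in> J \<Longrightarrow> y j \<in> {0, 1}" "\<And>i j. i \<in> I \<Longrightarrow> j \<in> J \<Longrightarrow> x i j \<in> {0, 1}"
      using that by (simp_all add: original_feasible_set_def s_eq I_def J_def)
    have "objective P s = val ({j\<in>J. y j = 1}, {(i, j)\<in>I \<times> J. x i j = 1})"
      unfolding s_eq val_def objective.simps prod.case I_def[symmetric] J_def[symmetric]
      using 01 by (intro arg_cong2[of _ _ _ _ "(+)"] sum.cong refl) force+
    then show ?thesis by blast
  qed
  then have "objective P ` original_feasible_set P \<subseteq> val ` (Pow J \<times> Pow (I \<times> J))" by blast
  then show ?thesis by (rule finite_subset) (use fin in simp)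
qed

theorem proposition5:
  fixes P :: "('i, 'j) cflcp"
  assumes "cflcp_instance P"
  shows "(relaxed_feasible_set P \<noteq> {} \<longleftrightarrow> original_feasible_set P \<noteq> {}) \<and>
         (original_feasible_set P \<noteq> {} \<longrightarrow>
           (\<exists>z. is_optimal_value (objective P) (original_feasible_set P) z \<and>
                is_optimal_value (objective P) (relaxed_feasible_set P) z))"
proof (intro conjI impI)
  show "relaxed_feasible_set P \<noteq> {} \<longleftrightarrow> original_feasible_set P \<noteq> {}"
    using relaxed_point_rounding[OF assms] original_subset_relaxed[of P] by blast
next
  \<comment> \<open>A single minimizer of the original model serves both models: it is feasible for
    the relaxed one, and any cheaper relaxed point would round to a cheaper original point.\<close>
  let ?V = "objective P ` original_feasible_set P"
  assume "original_feasible_set P \<noteq> {}"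
  then have "Min ?V \<in> ?V" using finite_original_objective[OF assms] by (intro Min_in) auto
  then obtain s where s: "s \<in> original_feasible_set P" "objective P s = Min ?V" by auto
  have min: "objective P s \<le> objective P s'" if "s' \<in> original_feasible_set P" for s'
    using finite_original_objective[OF assms] that s(2) by simp
  have "objective P s \<le> objective P s'" if "s' \<in> relaxed_feasible_set P" for s'
    using relaxed_point_rounding[OF assms that] min by (meson order_trans)
  then have "is_arg_min (objective P) (\<lambda>s. s \<in> relaxed_feasible_set P) s"
    "is_arg_min (objective P) (\<lambda>s. s \<in> original_feasible_set P) s"
    using s(1) min original_subset_relaxed[of P] by (auto simp: is_arg_min_linorder)
  then show "\<exists>z. is_optimal_value (objective P) (original_feasible_set P) z \<and>
                is_optimal_value (objective P) (relaxed_feasible_set P) z"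
    unfolding is_optimal_value_def by blast
qed

end
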